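(* Let $M$ be a commutative partial monoid that has the orthocomplement property with respect to an element $L\in M$, i.e. for every $x\in M$ there is a unique $x^\perp\in M$ such that $x\cdot x^\perp$ is defined and equal to $L$. Then the nerve $N_\bullet M$ has a cosymmetric structure (i.e. there is a functor $\Phi\to\mathbf{Set}$ whose underlying simplicial set is $N_\bullet M$), and thus an induced cyclic structure.
   Context: A *partial monoid* is a set $M$ with a partially defined operation $M_2\to M$, $(x,y)\mapsto x\cdot y$, $M_2\subseteq M\times M$, such that $(x\cdot y)\cdot z=x\cdot(y\cdot z)$ for all $x,y,z\in M$, and there is $e\in M$ with $e\cdot x=x\cdot e=x$ for all $x$; equalities mean that either both sides are defined and equal or both are undefined. It is commutative if $x\cdot y=y\cdot x$ for all $x,y$ in the same sense. The *nerve* $N_\bullet M$ is the simplicial set with $N_0M$ a point and $N_nM=\{(x_1,\dots,x_n)\in M^n\mid x_1\cdots x_n\text{ is defined}\}$, with $d_0$ deleting $x_1$, $d_n$ deleting $x_n$, $d_i$ ($0<i<n$) replacing $x_i,x_{i+1}$ by $x_i\cdot x_{i+1}$, and $s_i$ inserting $e$ after the $i$th entry. Write $[n]=\{0,1,\dots,n\}$. $\Phi$ is the full subcategory of $\mathbf{Set}$ on the objects $[n]$, $n\ge0$; a cosymmetric set is a functor $X_\bullet:\Phi\to\mathbf{Set}$. Its underlying simplicial set has face and degeneracy maps induced by the following maps in $\Phi$: for $0\le i<n$, $d_i^n:[n]\to[n-1]$ with $k\mapsto k$ for $k\le i$, $k\mapsto k-1$ for $k>i$; $d_n^n:[n]\to[n-1]$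 with $k\mapsto k$ for $k<n$, $n\mapsto0$; $s_i^n:[n]\to[n+1]$ ($0\le i\le n$) with $k\mapsto k$ for $k\le i$, $k\mapsto k+1$ for $k>i$. A cyclic structure on a simplicial set $X_\bullet$ consists of maps $\tau^n:X_n\to X_n$, $n\ge0$, with $(\tau^n)^{n+1}=\mathrm{id}$, $d_i^n\tau^n=\tau^{n-1}d_{i+1}^n$ for $i<n$, $d_n^n\tau^n=d_0^n$, $s_i^n\tau^n=\tau^{n+1}s_{i+1}^n$ for $i<n$, and $s_n^n\tau^n=(\tau^{n+1})^2s_0^n$. The cyclic structure induced by a cosymmetric structure has $\tau^n$ equal to the image of the permutation $[n]\to[n]$, $0\mapsto n$, $k\mapsto k-1$ for $k\ge1$. *)

theory Defs
  imports Main "HOL-Library.FuncSet"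
begin

section \<open>Partial monoids\<close>

text \<open>
  A product \<open>x \<cdot> y\<close> is undefined iff \<open>mul x y = None\<close>.  An iterated product is
  formed with \<^const>\<open>Option.bind\<close>, so equality of two such terms means that both are
  defined and equal or both are undefined.  The values of \<open>mul\<close> outside \<open>M\<close> are irrelevant.
  The unit is a parameter, but it is determined by \<open>M\<close> and \<open>mul\<close>.
\<close>

locale partial_monoid =
  fixes M :: "'a set" and mul :: "'a \<Rightarrow> 'a \<Rightarrow> 'a option" and e :: 'a
  assumes mul_closed: "\<lbrakk>x \<in> M; y \<in> M; mul x y = Some z\<rbrakk> \<Longrightarrow> z \<in> M"
    and mul_assoc: "\<lbrakk>x \<in> M; y \<in> M; z \<in> M\<rbrakk> \<Longrightarrow>
      Option.bind (mul x y) (\<lambda>u. mul u z) = Option.bind (mul y z) (\<lambda>v. mul x v)"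
    and unit_closed: "e \<in> M"
    and unit_left: "x \<in> M \<Longrightarrow> mul e x = Some x"
    and unit_right: "x \<in> M \<Longrightarrow> mul x e = Some x"

locale comm_partial_monoid = partial_monoid +
  assumes mul_commute: "\<lbrakk>x \<in> M; y \<in> M\<rbrakk> \<Longrightarrow> mul x y = mul y x"

definition orthocomplement_property ::
    "'a set \<Rightarrow> ('a \<Rightarrow> 'a \<Rightarrow> 'a option) \<Rightarrow> 'a \<Rightarrow> bool" where
  "orthocomplement_property M mul L \<longleftrightarrow>
     L \<in> M \<and> (\<forall>x\<in>M. \<exists>!y. y \<in> M \<and> mul x y = Some L)"


section \<open>Simplicial sets and cyclic structures\<close>

text \<open>
  \<open>d n i\<close> is the face map \<open>X n \<rightarrow> X (n - 1)\<close>, meaningful for \<open>1 \<le> n\<close>, \<open>i \<le> n\<close>, and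
  \<open>s n i\<close> is the degeneracy map \<open>X n \<rightarrow> X (n + 1)\<close>, meaningful for \<open>i \<le> n\<close>.
\<close>

locale simplicial_set =
  fixes X :: "nat \<Rightarrow> 'b set"
    and d :: "nat \<Rightarrow> nat \<Rightarrow> 'b \<Rightarrow> 'b"
    and s :: "nat \<Rightarrow> nat \<Rightarrow> 'b \<Rightarrow> 'b"
  assumes d_in: "\<lbrakk>1 \<le> n; i \<le> n\<rbrakk> \<Longrightarrow> d n i \<in> X n \<rightarrow> X (n - 1)"
    and s_in: "i \<le> n \<Longrightarrow> s n i \<in> X n \<rightarrow> X (n + 1)"
    and d_d: "\<lbrakk>2 \<le> n; i < j; j \<le> n; x \<in> X n\<rbrakk> \<Longrightarrow>
      d (n - 1) i (d n j x) = d (n - 1) (j - 1) (d n i x)"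
    and d_s_less: "\<lbrakk>i < j; j \<le> n; x \<in> X n\<rbrakk> \<Longrightarrow>
      d (n + 1) i (s n j x) = s (n - 1) (j - 1) (d n i x)"
    and d_s_same: "\<lbrakk>j \<le> n; i = j \<or> i = j + 1; x \<in> X n\<rbrakk> \<Longrightarrow> d (n + 1) i (s n j x) = x"
    and d_s_greater: "\<lbrakk>j + 1 < i; i \<le> n + 1; x \<in> X n\<rbrakk> \<Longrightarrow>
      d (n + 1) i (s n j x) = s (n - 1) j (d n (i - 1) x)"
    and s_s: "\<lbrakk>i \<le> j; j \<le> n; x \<in> X n\<rbrakk> \<Longrightarrow>
      s (n + 1) i (s n j x) = s (n + 1) (j + 1) (s n i x)"

locale cyclic_structure = simplicial_set +
  fixes \<tau> :: "nat \<Rightarrow> 'b \<Rightarrow> 'b"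
  assumes tau_in: "\<tau> n \<in> X n \<rightarrow> X n"
    and tau_power: "x \<in> X n \<Longrightarrow> (\<tau> n ^^ (n + 1)) x = x"
    and d_tau: "\<lbrakk>i < n; x \<in> X n\<rbrakk> \<Longrightarrow> d n i (\<tau> n x) = \<tau> (n - 1) (d n (i + 1) x)"
    and d_tau_last: "\<lbrakk>1 \<le> n; x \<in> X n\<rbrakk> \<Longrightarrow> d n n (\<tau> n x) = d n 0 x"
    and s_tau: "\<lbrakk>i < n; x \<in> X n\<rbrakk> \<Longrightarrow> s n i (\<tau> n x) = \<tau> (n + 1) (s n (i + 1) x)"
    and s_tau_last: "x \<in> X n \<Longrightarrow> s n n (\<tau> n x) = (\<tau> (n + 1) ^^ 2) (s n 0 x)"


section \<open>Cosymmetric sets\<close>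

text \<open>
  The object \<open>[n]\<close> of \<open>\<Phi>\<close> is \<^term>\<open>{..n::nat}\<close>, and morphisms, in \<open>\<Phi>\<close> as in the category
  of sets, are extensional functions, so that equality of functions is equality of morphisms.
\<close>

definition \<Phi>_hom :: "nat \<Rightarrow> nat \<Rightarrow> (nat \<Rightarrow> nat) set" where
  "\<Phi>_hom n m = {..n} \<rightarrow>\<^sub>E {..m}"

text \<open>\<open>F n m f\<close> is the value of the functor on the morphism \<open>f : [n] \<rightarrow> [m]\<close>.\<close>

locale cosymmetric_set =
  fixes X :: "nat \<Rightarrow> 'b set"
    and F :: "nat \<Rightarrow> nat \<Rightarrow> (nat \<Rightarrow> nat) \<Rightarrow> 'b \<Rightarrow> 'b"
  assumes F_in: "f \<in> \<Phi>_hom n m \<Longrightarrow> F n m f \<in> X n \<rightarrow>\<^sub>E X m"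
    and F_id: "F n n (\<lambda>k\<in>{..n}. k) = (\<lambda>x\<in>X n. x)"
    and F_comp: "\<lbrakk>f \<in> \<Phi>_hom n m; g \<in> \<Phi>_hom m l\<rbrakk> \<Longrightarrow>
      F n l (compose {..n} g f) = compose (X n) (F m l g) (F n m f)"

definition \<Phi>_d :: "nat \<Rightarrow> nat \<Rightarrow> nat \<Rightarrow> nat" where
  "\<Phi>_d n i = (\<lambda>k\<in>{..n}.
     if i < n then (if k \<le> i then k else k - 1) else (if k < n then k else 0))"

definition \<Phi>_s :: "nat \<Rightarrow> nat \<Rightarrow> nat \<Rightarrow> nat" where
  "\<Phi>_s n i = (\<lambda>k\<in>{..n}. if k \<le> i then k else k + 1)"

definition \<Phi>_tau :: "nat \<Rightarrow> nat \<Rightarrow> nat" where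
  "\<Phi>_tau n = (\<lambda>k\<in>{..n}. if k = 0 then n else k - 1)"

text \<open>A cosymmetric structure on a simplicial set: a functor with that underlying simplicial set.\<close>

locale cosymmetric_structure = simplicial_set X d s + cosymmetric_set X F
  for X :: "nat \<Rightarrow> 'b set" and d s F +
  assumes F_d: "\<lbrakk>1 \<le> n; i \<le> n; x \<in> X n\<rbrakk> \<Longrightarrow> F n (n - 1) (\<Phi>_d n i) x = d n i x"
    and F_s: "\<lbrakk>i \<le> n; x \<in> X n\<rbrakk> \<Longrightarrow> F n (n + 1) (\<Phi>_s n i) x = s n i x"

definition induced_tau ::
    "(nat \<Rightarrow> nat \<Rightarrow> (nat \<Rightarrow> nat) \<Rightarrow> 'b \<Rightarrow> 'b) \<Rightarrow> nat \<Rightarrow> 'b \<Rightarrow> 'b" where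
  "induced_tau F n = F n n (\<Phi>_tau n)"


section \<open>The nerve of a partial monoid\<close>

text \<open>The bracketing and the additional factor \<open>e\<close> at the end do not affect the value.\<close>

primrec list_product :: "('a \<Rightarrow> 'a \<Rightarrow> 'a option) \<Rightarrow> 'a \<Rightarrow> 'a list \<Rightarrow> 'a option" where
  "list_product mul e [] = Some e"
| "list_product mul e (x # xs) = Option.bind (list_product mul e xs) (mul x)"

definition nerve :: "'a set \<Rightarrow> ('a \<Rightarrow> 'a \<Rightarrow> 'a option) \<Rightarrow> 'a \<Rightarrow> nat \<Rightarrow> 'a list set" where
  "nerve M mul e n = {xs. length xs = n \<and> set xs \<subseteq> M \<and> list_product mul e xs \<noteq> None}"

text \<open>The entry \<open>x\<^sub>i\<close> of \<open>(x\<^sub>1, \<dots>, x\<^sub>n)\<close> is \<open>xs ! (i - 1)\<close>.\<close>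

definition nerve_d :: "('a \<Rightarrow> 'a \<Rightarrow> 'a option) \<Rightarrow> nat \<Rightarrow> nat \<Rightarrow> 'a list \<Rightarrow> 'a list" where
  "nerve_d mul n i xs =
     (if i = 0 then tl xs
      else if i = n then butlast xs
      else take (i - 1) xs @ [the (mul (xs ! (i - 1)) (xs ! i))] @ drop (i + 1) xs)"

definition nerve_s :: "'a \<Rightarrow> nat \<Rightarrow> nat \<Rightarrow> 'a list \<Rightarrow> 'a list" where
  "nerve_s e n i xs = take i xs @ [e] @ drop i xs"

end

theory Submission
  imports Defs "HOL-Algebra.FiniteProduct"
begin

text \<open>Let (x_1, ..., x_n) be a simplex with product p. Since p has a unique complement x_0,
  the simplex is the same datum as a tuple (x_0, ..., x_n) with product \<open>L\<close>, and in
  this form all n+1 entries play equal roles. A map f from [n] to [m] acts on such tuples by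
  pushforward: entry j of the image is the product of the x_i with f(i) = j. These products are
  defined because a subproduct of a defined commutative product is defined
  (\<open>fprod_subset_defined\<close>). Regrouping a product along the fibres of f
  (\<open>fprod_pushforward\<close>) shows both that the total product remains \<open>L\<close> and
  that the action is functorial (\<open>pushforward_compose\<close>). Forgetting x_0
  (\<open>of_coord\<close>) and restoring it (\<open>coord\<close>) are mutually inverse, so the
  action transfers to the nerve as \<open>nerve_map\<close>.

  The map inducing d_i merges two cyclically adjacent indices, so it multiplies adjacent entries; a
  merger with index 0 looks like a deletion because x_0 is hidden. The map inducing s_i misses i+1,
  where the empty product \<open>e\<close> appears. Hence the action induces the faces and
  degeneracies of the nerve (\<open>nerve_map_d\<close>, \<open>nerve_map_s\<close>). The simplicial
  and cyclic identities are images of identities between maps of finite sets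
  (\<open>structures_of_agreement\<close>).\<close>

section \<open>Simplicial and cyclic identities from functoriality\<close>

lemma \<Phi>_d_hom: "n = Suc m \<Longrightarrow> \<Phi>_d n i \<in> \<Phi>_hom n m"
  by (auto simp: \<Phi>_d_def \<Phi>_hom_def)

lemma \<Phi>_s_hom: "m = Suc n \<Longrightarrow> \<Phi>_s n i \<in> \<Phi>_hom n m"
  by (auto simp: \<Phi>_s_def \<Phi>_hom_def)

lemma \<Phi>_tau_hom: "\<Phi>_tau n \<in> \<Phi>_hom n n"
  by (auto simp: \<Phi>_tau_def \<Phi>_hom_def)

text \<open>The bound on \<open>k\<close> allows at most one wrap-around, which avoids modular
  arithmetic; \<open>k = n + 1\<close> yields the identity.\<close>

lemma \<Phi>_tau_funpow:
  assumes "j \<le> n" "k \<le> n + 1"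
  shows "(\<Phi>_tau n ^^ k) j = (if k \<le> j then j - k else j + (n + 1) - k)"
  using assms(2)
proof (induction k)
  case (Suc k)
  then show ?case
    using assms(1) by (auto simp: \<Phi>_tau_def)
qed simp

text \<open>A functor on \<Phi> is covariant, so each operator identity is checked on indices in the
  same order of composition. The last face sends n to 0, which is why the extreme indices are
  separate cases here and below.\<close>

lemma \<Phi>_d_d:
  assumes "2 \<le> n" "i < j" "j \<le> n" "k \<le> n"
  shows "\<Phi>_d (n - 1) i (\<Phi>_d n j k) = \<Phi>_d (n - 1) (j - 1) (\<Phi>_d n i k)"
  using assms
  by (cases "k \<le> i"; cases "k \<le> j"; cases "k = n"; cases "j = n"; simp add: \<Phi>_d_def; linarith?)

lemma \<Phi>_d_s_less:
  assumes "i < j" "j \<le> n" "k \<le> n"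
  shows "\<Phi>_d (n + 1) i (\<Phi>_s n j k) = \<Phi>_s (n - 1) (j - 1) (\<Phi>_d n i k)"
  using assms
  by (cases "k \<le> i"; cases "k \<le> j"; simp add: \<Phi>_d_def \<Phi>_s_def; linarith?)

lemma \<Phi>_d_s_same:
  assumes "j \<le> n" "i = j \<or> i = j + 1" "k \<le> n"
  shows "\<Phi>_d (n + 1) i (\<Phi>_s n j k) = k"
  using assms
  by (cases "k \<le> j"; cases "i = n + 1"; auto simp: \<Phi>_d_def \<Phi>_s_def)

lemma \<Phi>_d_s_greater:
  assumes "j + 1 < i" "i \<le> n + 1" "k \<le> n"
  shows "\<Phi>_d (n + 1) i (\<Phi>_s n j k) = \<Phi>_s (n - 1) j (\<Phi>_d n (i - 1) k)"
  using assms
  by (cases "k \<le> j"; cases "k < i"; cases "k = n"; cases "i = n + 1";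
      simp add: \<Phi>_d_def \<Phi>_s_def; linarith?)

lemma \<Phi>_s_s:
  assumes "i \<le> j" "j \<le> n" "k \<le> n"
  shows "\<Phi>_s (n + 1) i (\<Phi>_s n j k) = \<Phi>_s (n + 1) (j + 1) (\<Phi>_s n i k)"
  using assms by (auto simp: \<Phi>_s_def)

lemma \<Phi>_d_tau:
  assumes "i < n" "k \<le> n"
  shows "\<Phi>_d n i (\<Phi>_tau n k) = \<Phi>_tau (n - 1) (\<Phi>_d n (i + 1) k)"
  using assms
  by (cases "k = 0"; cases "k \<le> i + 1"; cases "i + 1 = n"; simp add: \<Phi>_d_def \<Phi>_tau_def; linarith?)

lemma \<Phi>_d_tau_last:
  assumes "1 \<le> n" "k \<le> n"
  shows "\<Phi>_d n n (\<Phi>_tau n k) = \<Phi>_d n 0 k"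
  using assms by (auto simp: \<Phi>_d_def \<Phi>_tau_def)

lemma \<Phi>_s_tau:
  assumes "i < n" "k \<le> n"
  shows "\<Phi>_s n i (\<Phi>_tau n k) = \<Phi>_tau (n + 1) (\<Phi>_s n (i + 1) k)"
  using assms
  by (cases "k = 0"; cases "k \<le> i + 1"; simp add: \<Phi>_s_def \<Phi>_tau_def; linarith?)

lemma \<Phi>_s_tau_last:
  assumes "k \<le> n"
  shows "\<Phi>_s n n (\<Phi>_tau n k) = (\<Phi>_tau (n + 1) ^^ 2) (\<Phi>_s n 0 k)"
  using assms by (cases "k = 0") (auto simp: \<Phi>_s_def \<Phi>_tau_def numeral_2_eq_2)

lemma \<Phi>_hom_apply: "\<lbrakk>f \<in> \<Phi>_hom n m; k \<le> n\<rbrakk> \<Longrightarrow> f k \<le> m"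
  by (auto simp: \<Phi>_hom_def)

section \<open>Transport of identities from \<Phi> to a cosymmetric set\<close>

context cosymmetric_set
begin

lemma F_apply_in: "\<lbrakk>f \<in> \<Phi>_hom n m; x \<in> X n\<rbrakk> \<Longrightarrow> F n m f x \<in> X m"
  using F_in by blast

lemma F_F: "\<lbrakk>f \<in> \<Phi>_hom n m; g \<in> \<Phi>_hom m l; x \<in> X n\<rbrakk> \<Longrightarrow>
    F m l g (F n m f x) = F n l (compose {..n} g f) x"
  by (simp add: F_comp compose_eq)

text \<open>Since \<open>compose\<close> restricts to \<open>{..n}\<close>, pointwise agreement
  there already gives equal morphisms. This rule and its two variants, for a single morphism or the
  identity on the right, convert the index computations into operator identities.\<close>

lemma F_square:
  assumes "f \<in> \<Phi>_hom n m" "g \<in> \<Phi>_hom m l" "f' \<in> \<Phi>_hom n m'" "g' \<in> \<Phi>_hom m' l" "x \<in> X n"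
    and "\<And>k. k \<le> n \<Longrightarrow> g (f k) = g' (f' k)"
  shows "F m l g (F n m f x) = F m' l g' (F n m' f' x)"
proof -
  have "compose {..n} g f = compose {..n} g' f'"
    using assms(6) by (auto simp: compose_def)
  then show ?thesis
    using assms(1-5) by (simp add: F_F)
qed

lemma F_triangle:
  assumes "f \<in> \<Phi>_hom n m" "g \<in> \<Phi>_hom m l" "h \<in> \<Phi>_hom n l" "x \<in> X n"
    and "\<And>k. k \<le> n \<Longrightarrow> g (f k) = h k"
  shows "F m l g (F n m f x) = F n l h x"
proof -
  have "compose {..n} g f = h"
    using assms(3,5) by (auto simp: compose_def \<Phi>_hom_def fun_eq_iff PiE_def extensional_def)
  then show ?thesis
    using assms(1,2,4) by (simp add: F_F)
qed

lemma F_ident: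
  assumes "f \<in> \<Phi>_hom n n" "x \<in> X n" "\<And>k. k \<le> n \<Longrightarrow> f k = k"
  shows "F n n f x = x"
proof -
  have "f = (\<lambda>k\<in>{..n}. k)"
    using assms(1,3) by (auto simp: \<Phi>_hom_def fun_eq_iff PiE_def extensional_def)
  then show ?thesis
    using F_id[of n] assms(2) by (metis restrict_apply')
qed

lemma F_retract:
  assumes "f \<in> \<Phi>_hom n m" "g \<in> \<Phi>_hom m n" "x \<in> X n" "\<And>k. k \<le> n \<Longrightarrow> g (f k) = k"
  shows "F m n g (F n m f x) = x"
proof -
  have "compose {..n} g f \<in> \<Phi>_hom n n"
    using assms(1,2) by (auto simp: \<Phi>_hom_def compose_def)
  then show ?thesis
    using assms by (simp add: F_F F_ident compose_eq)
qed

text \<open>The power must be restricted: \<open>f ^^ 0\<close> is the identity on all naturals,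
  which is not extensional and hence not a morphism.\<close>

lemma F_funpow:
  assumes "f \<in> \<Phi>_hom n n" "x \<in> X n"
  shows "(F n n f ^^ k) x = F n n (\<lambda>j\<in>{..n}. (f ^^ k) j) x"
proof (induction k)
  case 0
  have "F n n (\<lambda>j\<in>{..n}. (f ^^ 0) j) x = x"
    using assms(2) by (intro F_ident) (auto simp: \<Phi>_hom_def)
  then show ?case
    by (simp only: funpow_0)
next
  case (Suc k)
  have "(f ^^ k) j \<le> n" if "j \<le> n" for j
    using that assms(1) by (induction k) (auto simp: \<Phi>_hom_apply)
  then have "(\<lambda>j\<in>{..n}. (f ^^ k) j) \<in> \<Phi>_hom n n" "(\<lambda>j\<in>{..n}. (f ^^ Suc k) j) \<in> \<Phi>_hom n n"
    using assms(1) by (auto simp: \<Phi>_hom_def)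
  then have "F n n f (F n n (\<lambda>j\<in>{..n}. (f ^^ k) j) x) = F n n (\<lambda>j\<in>{..n}. (f ^^ Suc k) j) x"
    using assms by (intro F_triangle) auto
  then show ?case
    by (simp only: funpow.simps comp_apply Suc.IH)
qed

text \<open>Not even the simplicial identities of \<open>d\<close> and \<open>s\<close> are assumed;
  they too are inherited from \<Phi>. Stating the degrees as \<open>n = Suc m\<close> and
  \<open>m = Suc n\<close> makes the hypotheses apply to any form of the index, such as
  \<open>n - 1\<close> or \<open>n + 1\<close>.\<close>

lemma structures_of_agreement:
  assumes F_d: "\<And>n m i x. \<lbrakk>n = Suc m; i \<le> n; x \<in> X n\<rbrakk> \<Longrightarrow> F n m (\<Phi>_d n i) x = d n i x"
    and F_s: "\<And>n m i x. \<lbrakk>m = Suc n; i \<le> n; x \<in> X n\<rbrakk> \<Longrightarrow> F n m (\<Phi>_s n i) x = s n i x"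
  shows "cosymmetric_structure X d s F" and "cyclic_structure X d s (induced_tau F)"
proof -
  have d_mem: "d n i x \<in> X m" if "n = Suc m" "i \<le> n" "x \<in> X n" for n m i x
    using F_apply_in[OF \<Phi>_d_hom[OF that(1)] that(3), of i] F_d[OF that] by simp
  have s_mem: "s n i x \<in> X m" if "m = Suc n" "i \<le> n" "x \<in> X n" for n m i x
    using F_apply_in[OF \<Phi>_s_hom[OF that(1)] that(3), of i] F_s[OF that] by simp
  interpret simplicial_set X d s
  proof
    show "d n i \<in> X n \<rightarrow> X (n - 1)" if "1 \<le> n" "i \<le> n" for n i
      using that d_mem[of n "n - 1" i] by auto
    show "s n i \<in> X n \<rightarrow> X (n + 1)" if "i \<le> n" for n i
      using that s_mem[of "n + 1" n i] by auto
  next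
    fix n i j x assume a: "2 \<le> n" "i < j" "j \<le> n" "x \<in> X n"
    have "F (n - 1) (n - 1 - 1) (\<Phi>_d (n - 1) i) (F n (n - 1) (\<Phi>_d n j) x) =
        F (n - 1) (n - 1 - 1) (\<Phi>_d (n - 1) (j - 1)) (F n (n - 1) (\<Phi>_d n i) x)"
      by (rule F_square; (intro \<Phi>_d_hom \<Phi>_s_hom \<Phi>_tau_hom \<Phi>_d_d)?) (use a in auto)
    then show "d (n - 1) i (d n j x) = d (n - 1) (j - 1) (d n i x)"
      using a by (simp add: F_d F_s d_mem s_mem)
  next
    fix n i j x assume a: "i < j" "j \<le> n" "x \<in> X n"
    have "F (n + 1) n (\<Phi>_d (n + 1) i) (F n (n + 1) (\<Phi>_s n j) x) =
        F (n - 1) n (\<Phi>_s (n - 1) (j - 1)) (F n (n - 1) (\<Phi>_d n i) x)"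
      by (rule F_square; (intro \<Phi>_d_hom \<Phi>_s_hom \<Phi>_tau_hom \<Phi>_d_s_less)?) (use a in auto)
    then show "d (n + 1) i (s n j x) = s (n - 1) (j - 1) (d n i x)"
      using a by (simp add: F_d F_s d_mem s_mem)
  next
    fix n i j x assume a: "j \<le> n" "i = j \<or> i = j + 1" "x \<in> X n"
    have "F (n + 1) n (\<Phi>_d (n + 1) i) (F n (n + 1) (\<Phi>_s n j) x) = x"
      by (rule F_retract; (intro \<Phi>_d_hom \<Phi>_s_hom \<Phi>_d_s_same)?) (use a in auto)
    then show "d (n + 1) i (s n j x) = x"
      using a by (auto simp: F_d F_s d_mem s_mem)
  next
    fix n i j x assume a: "j + 1 < i" "i \<le> n + 1" "x \<in> X n"
    have "F (n + 1) n (\<Phi>_d (n + 1) i) (F n (n + 1) (\<Phi>_s n j) x) =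
        F (n - 1) n (\<Phi>_s (n - 1) j) (F n (n - 1) (\<Phi>_d n (i - 1)) x)"
      by (rule F_square; (intro \<Phi>_d_hom \<Phi>_s_hom \<Phi>_tau_hom \<Phi>_d_s_greater)?) (use a in auto)
    then show "d (n + 1) i (s n j x) = s (n - 1) j (d n (i - 1) x)"
      using a by (simp add: F_d F_s d_mem s_mem)
  next
    fix n i j x assume a: "i \<le> j" "j \<le> n" "x \<in> X n"
    have "F (n + 1) (n + 1 + 1) (\<Phi>_s (n + 1) i) (F n (n + 1) (\<Phi>_s n j) x) =
        F (n + 1) (n + 1 + 1) (\<Phi>_s (n + 1) (j + 1)) (F n (n + 1) (\<Phi>_s n i) x)"
      by (rule F_square; (intro \<Phi>_d_hom \<Phi>_s_hom \<Phi>_tau_hom \<Phi>_s_s)?) (use a in auto)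
    then show "s (n + 1) i (s n j x) = s (n + 1) (j + 1) (s n i x)"
      using a by (simp add: F_d F_s d_mem s_mem)
  qed
  show "cosymmetric_structure X d s F"
    by unfold_locales (auto simp: F_d F_s simp del: One_nat_def)
  have tau_mem: "induced_tau F n x \<in> X n" if "x \<in> X n" for n x
    unfolding induced_tau_def using F_apply_in[OF \<Phi>_tau_hom that] .
  show "cyclic_structure X d s (induced_tau F)"
  proof
    show "induced_tau F n \<in> X n \<rightarrow> X n" for n
      using tau_mem by blast
  next
    fix n x assume a: "x \<in> X n"
    have "F n n (\<lambda>j\<in>{..n}. (\<Phi>_tau n ^^ (n + 1)) j) x = x"
    proof (rule F_ident[OF _ a])
      show "(\<lambda>j\<in>{..n}. (\<Phi>_tau n ^^ (n + 1)) j) \<in> \<Phi>_hom n n"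
        by (auto simp: \<Phi>_hom_def \<Phi>_tau_funpow simp del: funpow.simps)
      show "(\<lambda>j\<in>{..n}. (\<Phi>_tau n ^^ (n + 1)) j) k = k" if "k \<le> n" for k
        using that by (simp add: \<Phi>_tau_funpow del: funpow.simps)
    qed
    then show "(induced_tau F n ^^ (n + 1)) x = x"
      unfolding induced_tau_def F_funpow[OF \<Phi>_tau_hom a] .
  next
    fix n i x assume a: "i < n" "x \<in> X n"
    have "F n (n - 1) (\<Phi>_d n i) (F n n (\<Phi>_tau n) x) =
        F (n - 1) (n - 1) (\<Phi>_tau (n - 1)) (F n (n - 1) (\<Phi>_d n (i + 1)) x)"
      by (rule F_square; (intro \<Phi>_d_hom \<Phi>_s_hom \<Phi>_tau_hom \<Phi>_d_tau)?) (use a in auto)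
    then show "d n i (induced_tau F n x) = induced_tau F (n - 1) (d n (i + 1) x)"
      using a by (simp add: F_d F_s d_mem s_mem tau_mem flip: induced_tau_def)
  next
    fix n x assume a: "1 \<le> n" "x \<in> X n"
    have "F n (n - 1) (\<Phi>_d n n) (F n n (\<Phi>_tau n) x) = F n (n - 1) (\<Phi>_d n 0) x"
      by (rule F_triangle; (intro \<Phi>_d_hom \<Phi>_tau_hom \<Phi>_d_tau_last)?) (use a in auto)
    then show "d n n (induced_tau F n x) = d n 0 x"
      using a by (simp add: F_d F_s d_mem s_mem tau_mem flip: induced_tau_def)
  next
    fix n i x assume a: "i < n" "x \<in> X n"
    have "F n (n + 1) (\<Phi>_s n i) (F n n (\<Phi>_tau n) x) =
        F (n + 1) (n + 1) (\<Phi>_tau (n + 1)) (F n (n + 1) (\<Phi>_s n (i + 1)) x)"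
      by (rule F_square; (intro \<Phi>_d_hom \<Phi>_s_hom \<Phi>_tau_hom \<Phi>_s_tau)?) (use a in auto)
    then show "s n i (induced_tau F n x) = induced_tau F (n + 1) (s n (i + 1) x)"
      using a by (simp add: F_d F_s d_mem s_mem tau_mem flip: induced_tau_def)
  next
    fix n x assume a: "x \<in> X n"
    \<comment> \<open>The square of the rotation is treated as one morphism so that
      \<open>F_square\<close> applies; \<open>F_funpow\<close> then splits it again.\<close>
    have "F n (n + 1) (\<Phi>_s n n) (F n n (\<Phi>_tau n) x) =
        F (n + 1) (n + 1) (\<lambda>j\<in>{..n + 1}. (\<Phi>_tau (n + 1) ^^ 2) j) (F n (n + 1) (\<Phi>_s n 0) x)"
    proof (rule F_square[OF \<Phi>_tau_hom \<Phi>_s_hom \<Phi>_s_hom _ a])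
      show "(\<lambda>j\<in>{..n + 1}. (\<Phi>_tau (n + 1) ^^ 2) j) \<in> \<Phi>_hom (n + 1) (n + 1)"
        by (auto simp: \<Phi>_hom_def \<Phi>_tau_def numeral_2_eq_2)
      show "\<Phi>_s n n (\<Phi>_tau n k) = (\<lambda>j\<in>{..n + 1}. (\<Phi>_tau (n + 1) ^^ 2) j) (\<Phi>_s n 0 k)"
        if "k \<le> n" for k
        using that \<Phi>_hom_apply[OF \<Phi>_s_hom[OF refl] that, of 0]
        by (simp add: \<Phi>_s_tau_last)
    qed auto
    also have "\<dots> = (induced_tau F (n + 1) ^^ 2) (F n (n + 1) (\<Phi>_s n 0) x)"
      unfolding induced_tau_def
      using F_funpow[OF \<Phi>_tau_hom F_apply_in[OF \<Phi>_s_hom a]] by simp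
    finally show "s n n (induced_tau F n x) = (induced_tau F (n + 1) ^^ 2) (s n 0 x)"
      using a by (simp add: F_d F_s d_mem s_mem tau_mem flip: induced_tau_def)
  qed
qed

end

section \<open>Products in a commutative partial monoid\<close>

text \<open>Adjoining \<^const>\<open>None\<close> as an absorbing element makes the product total.\<close>

definition option_monoid :: "'a set \<Rightarrow> ('a \<Rightarrow> 'a \<Rightarrow> 'a option) \<Rightarrow> 'a \<Rightarrow> 'a option monoid" where
  "option_monoid M mul e =
    \<lparr>carrier = insert None (Some ` M),
     mult = (\<lambda>x y. Option.bind x (\<lambda>u. Option.bind y (mul u))), one = Some e\<rparr>"

lemma option_monoid_simps [simp]:
  "carrier (option_monoid M mul e) = insert None (Some ` M)"
  "x \<otimes>\<^bsub>option_monoid M mul e\<^esub> y = Option.bind x (\<lambda>u. Option.bind y (mul u))"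
  "\<one>\<^bsub>option_monoid M mul e\<^esub> = Some e"
  by (simp_all add: option_monoid_def)

context comm_partial_monoid
begin

abbreviation G :: "'a option monoid" where
  "G \<equiv> option_monoid M mul e"

text \<open>Equality with both sides possibly undefined is exactly associativity in the totalised
  monoid. This makes \<open>finprod\<close> available, that is, products indexed by finite sets
  without an order.\<close>

lemma comm_monoid_option_monoid: "Group.comm_monoid G"
proof (rule comm_monoidI)
  fix x y assume "x \<in> carrier G" "y \<in> carrier G"
  then show "x \<otimes>\<^bsub>G\<^esub> y \<in> carrier G"
    by (cases "x \<otimes>\<^bsub>G\<^esub> y") (auto simp: bind_eq_Some_conv dest: mul_closed)
next
  fix x y z assume "x \<in> carrier G" "y \<in> carrier G" "z \<in> carrier G"
  then consider "x = None" | "y = None" | "z = None"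
    | a b c where "x = Some a" "y = Some b" "z = Some c" "a \<in> M" "b \<in> M" "c \<in> M"
    by auto
  then show "x \<otimes>\<^bsub>G\<^esub> y \<otimes>\<^bsub>G\<^esub> z = x \<otimes>\<^bsub>G\<^esub> (y \<otimes>\<^bsub>G\<^esub> z)"
  proof cases
    case 4
    then show ?thesis
      using mul_assoc[of a b c] by simp
  qed simp_all
next
  fix x y assume "x \<in> carrier G" "y \<in> carrier G"
  then consider "x = None" | "y = None" | a b where "x = Some a" "y = Some b" "a \<in> M" "b \<in> M"
    by auto
  then show "x \<otimes>\<^bsub>G\<^esub> y = y \<otimes>\<^bsub>G\<^esub> x"
  proof cases
    case 3
    then show ?thesis
      using mul_commute[of a b] by simp
  qed simp_all
next
  fix x assume "x \<in> carrier G"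
  then show "\<one>\<^bsub>G\<^esub> \<otimes>\<^bsub>G\<^esub> x = x"
    by (auto simp: unit_left)
qed (simp add: unit_closed)

sublocale G: Group.comm_monoid G
  by (rule comm_monoid_option_monoid)

text \<open>Indexing by a set rather than a list allows products over fibres of maps that need not
  be monotone. The value \<open>None\<close> means that the product is undefined.\<close>

definition fprod :: "(nat \<Rightarrow> 'a) \<Rightarrow> nat set \<Rightarrow> 'a option" where
  "fprod a A = finprod G (\<lambda>i. Some (a i)) A"

lemma fprod_cong:
  assumes "\<And>i. i \<in> A \<Longrightarrow> a i \<in> M" "\<And>i. i \<in> A \<Longrightarrow> a i = b i"
  shows "fprod a A = fprod b A"
  unfolding fprod_def using assms by (intro G.finprod_cong') auto

lemma fprod_closed: "(\<And>i. i \<in> A \<Longrightarrow> a i \<in> M) \<Longrightarrow> fprod a A = Some x \<Longrightarrow> x \<in> M"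
  unfolding fprod_def using G.finprod_closed[of "\<lambda>i. Some (a i)" A] by auto

lemma fprod_empty: "fprod a {} = Some e"
  by (simp add: fprod_def)

lemma fprod_insert:
  assumes "finite A" "i \<notin> A" "a i \<in> M" "\<And>j. j \<in> A \<Longrightarrow> a j \<in> M"
  shows "fprod a (insert i A) = Option.bind (fprod a A) (mul (a i))"
  unfolding fprod_def using assms by (subst G.finprod_insert) auto

lemma fprod_singleton: "a i \<in> M \<Longrightarrow> fprod a {i} = Some (a i)"
  using fprod_insert[of "{}" i a] by (simp add: fprod_empty unit_right)

lemma fprod_pair: "\<lbrakk>i \<noteq> j; a i \<in> M; a j \<in> M\<rbrakk> \<Longrightarrow> fprod a {i, j} = mul (a i) (a j)"
  using fprod_insert[of "{j}" i a] by (simp add: fprod_singleton)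

text \<open>The product over \<open>B\<close> factors through \<open>A\<close> and its complement,
  and \<open>None\<close> is absorbing.\<close>

lemma fprod_subset_defined:
  assumes "finite B" "A \<subseteq> B" "\<And>i. i \<in> B \<Longrightarrow> a i \<in> M" "fprod a B \<noteq> None"
  shows "fprod a A \<noteq> None"
proof -
  have "fprod a (A \<union> (B - A)) = fprod a A \<otimes>\<^bsub>G\<^esub> fprod a (B - A)"
    unfolding fprod_def using assms finite_subset[OF assms(2,1)]
    by (intro G.finprod_Un_disjoint) auto
  then show ?thesis
    using assms(2,4) by (cases "fprod a A") (auto simp: Un_absorb1)
qed

text \<open>General associativity and commutativity: multiplying within blocks first does not change
  the product, even as regards being defined.\<close>

lemma fprod_UN_disjoint:
  assumes "finite I" "\<And>j. j \<in> I \<Longrightarrow> finite (A j)" "pairwise (\<lambda>j k. disjnt (A j) (A k)) I"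
    and "\<And>i j. \<lbrakk>j \<in> I; i \<in> A j\<rbrakk> \<Longrightarrow> a i \<in> M"
    and "\<And>j. j \<in> I \<Longrightarrow> fprod a (A j) = Some (b j)"
  shows "fprod a (\<Union>j\<in>I. A j) = fprod b I"
proof -
  have b: "b j \<in> M" if "j \<in> I" for j
    using fprod_closed[OF _ assms(5)[OF that]] assms(4) that by blast
  have "fprod a (\<Union>j\<in>I. A j) = finprod G (\<lambda>j. fprod a (A j)) I"
    unfolding fprod_def using assms(1-4) by (intro G.finprod_UN_disjoint) (auto simp: pairwise_def)
  also have "\<dots> = fprod b I"
    unfolding fprod_def[of b] using assms(5) b by (intro G.finprod_cong') auto
  finally show ?thesis .
qed

lemma list_product_closed: "\<lbrakk>set xs \<subseteq> M; list_product mul e xs = Some x\<rbrakk> \<Longrightarrow> x \<in> M"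
  by (induction xs arbitrary: x) (auto simp: unit_closed bind_eq_Some_conv intro: mul_closed)

text \<open>Links the ordered product used by the nerve to the unordered one; distinctness matters
  because a set forgets repetitions.\<close>

lemma list_product_map:
  assumes "distinct is" "\<And>i. i \<in> set is \<Longrightarrow> a i \<in> M"
  shows "list_product mul e (map a is) = fprod a (set is)"
  using assms by (induction "is") (auto simp: fprod_empty fprod_insert)

section \<open>Tuples with product \<open>L\<close>\<close>

text \<open>On \<open>tuples\<close> the use of \<open>the\<close> is harmless: every fibre has a
  defined product by \<open>fprod_fibre\<close>.\<close>

definition pushforward :: "nat \<Rightarrow> (nat \<Rightarrow> nat) \<Rightarrow> (nat \<Rightarrow> 'a) \<Rightarrow> nat \<Rightarrow> 'a" where
  "pushforward n f a j = the (fprod a {i \<in> {..n}. f i = j})"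

text \<open>The symmetric model of the n-simplices. Values beyond \<open>n\<close> are left free, so
  tuples are compared only on indices up to \<open>n\<close>.\<close>

definition tuples :: "'a \<Rightarrow> nat \<Rightarrow> (nat \<Rightarrow> 'a) set" where
  "tuples L n = {a. a ` {..n} \<subseteq> M \<and> fprod a {..n} = Some L}"

lemma fprod_fibre:
  assumes "a \<in> tuples L n"
  shows "fprod a {i \<in> {..n}. P i} = Some (the (fprod a {i \<in> {..n}. P i}))"
proof -
  have "fprod a {i \<in> {..n}. P i} \<noteq> None"
    by (rule fprod_subset_defined[of "{..n}"]) (use assms in \<open>auto simp: tuples_def\<close>)
  then show ?thesis
    by (rule option.collapse[symmetric])
qed

text \<open>The fibres over the points of \<open>B\<close> partition its preimage. Taking
  \<open>B = {..m}\<close> shows that the total product is preserved; taking a fibre of a second map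
  gives functoriality.\<close>

lemma fprod_pushforward:
  assumes "a \<in> tuples L n" "finite B"
  shows "fprod (pushforward n f a) B = fprod a {i \<in> {..n}. f i \<in> B}"
proof -
  have "fprod a (\<Union>j\<in>B. {i \<in> {..n}. f i = j}) = fprod (pushforward n f a) B"
  proof (rule fprod_UN_disjoint)
    show "fprod a {i \<in> {..n}. f i = j} = Some (pushforward n f a j)" for j
      unfolding pushforward_def by (rule fprod_fibre[OF assms(1)])
    show "a i \<in> M" if "i \<in> {i \<in> {..n}. f i = j}" for i j
      using that assms(1) by (auto simp: tuples_def)
  qed (auto simp: assms(2) pairwise_def disjnt_def)
  moreover have "(\<Union>j\<in>B. {i \<in> {..n}. f i = j}) = {i \<in> {..n}. f i \<in> B}"
    by auto
  ultimately show ?thesis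
    by simp
qed

lemma pushforward_closed:
  assumes "a \<in> tuples L n"
  shows "pushforward n f a j \<in> M"
proof (rule fprod_closed)
  show "fprod a {i \<in> {..n}. f i = j} = Some (pushforward n f a j)"
    unfolding pushforward_def by (rule fprod_fibre[OF assms])
qed (use assms in \<open>auto simp: tuples_def\<close>)

lemma pushforward_tuples:
  assumes "a \<in> tuples L n" "f \<in> \<Phi>_hom n m"
  shows "pushforward n f a \<in> tuples L m"
proof -
  have "{i \<in> {..n}. f i \<in> {..m}} = {..n}"
    using assms(2) by (auto simp: \<Phi>_hom_def)
  then have "fprod (pushforward n f a) {..m} = fprod a {..n}"
    by (simp add: fprod_pushforward[OF assms(1)])
  then show ?thesis
    using assms(1) pushforward_closed[OF assms(1)] by (simp add: tuples_def image_subset_iff)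
qed

lemma pushforward_compose:
  assumes "a \<in> tuples L n" "f \<in> \<Phi>_hom n m"
  shows "pushforward m g (pushforward n f a) j = pushforward n (compose {..n} g f) a j"
proof -
  have "{i \<in> {..n}. f i \<in> {k \<in> {..m}. g k = j}} = {i \<in> {..n}. compose {..n} g f i = j}"
    using assms(2) by (auto simp: \<Phi>_hom_def compose_def)
  then show ?thesis
    unfolding pushforward_def[of m] pushforward_def[of n "compose {..n} g f"]
    by (simp add: fprod_pushforward[OF assms(1)])
qed

lemma pushforward_cong:
  assumes "\<And>i. i \<le> n \<Longrightarrow> a i \<in> M" "\<And>i. i \<le> n \<Longrightarrow> a i = b i"
  shows "pushforward n f a j = pushforward n f b j"
  unfolding pushforward_def using assms by (subst fprod_cong[of _ a b]) auto

end

section \<open>Simplices of the nerve as tuples with product \<open>L\<close>\<close>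

locale orthocomplemented_partial_monoid = comm_partial_monoid +
  fixes L
  assumes orthocomplement: "orthocomplement_property M mul L"
begin

definition perp :: "'a \<Rightarrow> 'a" where
  "perp x = (THE y. y \<in> M \<and> mul x y = Some L)"

lemma ex1_perp: "x \<in> M \<Longrightarrow> \<exists>!y. y \<in> M \<and> mul x y = Some L"
  using orthocomplement by (simp add: orthocomplement_property_def)

lemma perp: "x \<in> M \<Longrightarrow> perp x \<in> M \<and> mul x (perp x) = Some L"
  unfolding perp_def by (rule theI'[OF ex1_perp])

lemma perp_eqI: "\<lbrakk>x \<in> M; y \<in> M; mul x y = Some L\<rbrakk> \<Longrightarrow> perp x = y"
  unfolding perp_def by (rule the1_equality[OF ex1_perp]) simp_all

text \<open>Index 0 receives the factor that completes the product to \<open>L\<close>; the shift by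
  one lets the mathematical index i of x_i survive.\<close>

definition coord :: "'a list \<Rightarrow> nat \<Rightarrow> 'a" where
  "coord xs i = (if i = 0 then perp (the (list_product mul e xs)) else xs ! (i - 1))"

definition of_coord :: "nat \<Rightarrow> (nat \<Rightarrow> 'a) \<Rightarrow> 'a list" where
  "of_coord n a = map a [1..<n + 1]"

lemma length_of_coord [simp]: "length (of_coord n a) = n"
  by (simp add: of_coord_def)

lemma nth_of_coord [simp]: "i < n \<Longrightarrow> of_coord n a ! i = a (i + 1)"
  by (simp add: of_coord_def del: upt_Suc)

lemma of_coord_coord: "length xs = n \<Longrightarrow> of_coord n (coord xs) = xs"
  by (rule nth_equalityI) (auto simp: coord_def)

lemma atMost_eq_insert: "{..n} = insert 0 {1..<n + 1}" for n :: nat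
  by auto

lemma list_product_of_coord:
  assumes "\<And>i. \<lbrakk>1 \<le> i; i \<le> n\<rbrakk> \<Longrightarrow> a i \<in> M"
  shows "list_product mul e (of_coord n a) = fprod a {1..<n + 1}"
  unfolding of_coord_def using list_product_map[of "[1..<n + 1]" a] assms
  by (simp del: upt_Suc)

text \<open>With p the product of the list, the total is \<open>mul (perp p) p\<close>, which
  commutativity turns into the defining equation of \<open>perp\<close>.\<close>

lemma coord_tuples:
  assumes "xs \<in> nerve M mul e n"
  shows "coord xs \<in> tuples L n"
proof -
  obtain p where p: "list_product mul e xs = Some p"
    using assms by (auto simp: nerve_def)
  have len: "length xs = n" and sub: "set xs \<subseteq> M"
    using assms by (auto simp: nerve_def)
  have pM: "p \<in> M"
    using list_product_closed[OF sub p] .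
  have 0: "coord xs 0 = perp p"
    by (simp add: coord_def p)
  have mem: "coord xs i \<in> M" if "1 \<le> i" "i \<le> n" for i
    using that len sub by (auto simp: coord_def)
  have "fprod (coord xs) {1..<n + 1} = Some p"
    using list_product_of_coord[of n "coord xs"] mem len p by (simp add: of_coord_coord)
  then have "fprod (coord xs) {..n} = mul (perp p) p"
    unfolding atMost_eq_insert using mem perp[OF pM] by (subst fprod_insert) (auto simp: 0)
  then show ?thesis
    using perp[OF pM] pM mem mul_commute[of p "perp p"] 0
    by (auto simp: tuples_def) (metis One_nat_def Suc_leI neq0_conv)
qed

text \<open>Splitting off index 0 shows that the remaining entries have a defined product, hence
  form a simplex, and that \<open>a 0\<close> is a complement of it.\<close>

lemma tuples_split:
  assumes "a \<in> tuples L n"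
  obtains p where "list_product mul e (of_coord n a) = Some p" "p \<in> M" "mul (a 0) p = Some L"
proof -
  have mem: "a i \<in> M" if "i \<le> n" for i
    using assms that by (auto simp: tuples_def)
  have "fprod a {..n} = Option.bind (fprod a {1..<n + 1}) (mul (a 0))"
    unfolding atMost_eq_insert using mem by (subst fprod_insert) auto
  then obtain p where p: "fprod a {1..<n + 1} = Some p" "mul (a 0) p = Some L"
    using assms by (auto simp: tuples_def bind_eq_Some_conv)
  moreover have "p \<in> M"
    using fprod_closed[OF _ p(1)] mem by auto
  ultimately show ?thesis
    using that list_product_of_coord[of n a] mem by auto
qed

lemma of_coord_nerve:
  assumes "a \<in> tuples L n"
  shows "of_coord n a \<in> nerve M mul e n"
proof -
  obtain p where "list_product mul e (of_coord n a) = Some p"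
    using tuples_split[OF assms] .
  moreover have "set (of_coord n a) \<subseteq> M"
    using assms by (auto simp: tuples_def of_coord_def simp del: upt_Suc)
  ultimately show ?thesis
    by (simp add: nerve_def)
qed

text \<open>Uniqueness of the complement makes the forgotten entry \<open>a 0\<close>
  recoverable.\<close>

lemma coord_of_coord:
  assumes "a \<in> tuples L n" "i \<le> n"
  shows "coord (of_coord n a) i = a i"
proof (cases "i = 0")
  case True
  obtain p where p: "list_product mul e (of_coord n a) = Some p" "p \<in> M" "mul (a 0) p = Some L"
    using tuples_split[OF assms(1)] .
  have "a 0 \<in> M"
    using assms(1) by (auto simp: tuples_def)
  then have "perp p = a 0"
    using p mul_commute[of "a 0" p] by (intro perp_eqI) auto
  then show ?thesis
    using True p by (simp add: coord_def)
next
  case False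
  then show ?thesis
    using assms(2) by (simp add: coord_def)
qed

section \<open>The action of \<Phi> on the nerve\<close>

definition nerve_map :: "nat \<Rightarrow> nat \<Rightarrow> (nat \<Rightarrow> nat) \<Rightarrow> 'a list \<Rightarrow> 'a list" where
  "nerve_map n m f = (\<lambda>xs\<in>nerve M mul e n. of_coord m (pushforward n f (coord xs)))"

lemma nerve_map_nth:
  assumes "xs \<in> nerve M mul e n" "j < m"
  shows "nerve_map n m f xs ! j = pushforward n f (coord xs) (j + 1)"
  using assms by (simp add: nerve_map_def)

lemma length_nerve_map: "xs \<in> nerve M mul e n \<Longrightarrow> length (nerve_map n m f xs) = m"
  by (simp add: nerve_map_def)

lemma nerve_map_in:
  assumes "f \<in> \<Phi>_hom n m" "xs \<in> nerve M mul e n"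
  shows "nerve_map n m f xs \<in> nerve M mul e m"
  using assms by (simp add: nerve_map_def of_coord_nerve pushforward_tuples coord_tuples)

lemma coord_closed: "\<lbrakk>xs \<in> nerve M mul e n; i \<le> n\<rbrakk> \<Longrightarrow> coord xs i \<in> M"
  using coord_tuples[of xs n] by (auto simp: tuples_def)

text \<open>Covers all entries that a face or degeneracy merely moves.\<close>

lemma pushforward_fibre_singleton:
  assumes "xs \<in> nerve M mul e n" "{i \<in> {..n}. f i = j} = {k}"
  shows "pushforward n f (coord xs) j = coord xs k"
proof -
  have "k \<le> n"
    using assms(2) by auto
  then show ?thesis
    using assms by (simp add: pushforward_def fprod_singleton coord_closed)
qed

text \<open>Functoriality of \<open>pushforward\<close> carries over because, between two successive
  maps, \<open>of_coord\<close> and \<open>coord\<close> cancel.\<close>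

lemma cosymmetric_nerve_map: "cosymmetric_set (nerve M mul e) nerve_map"
proof
  show "nerve_map n m f \<in> nerve M mul e n \<rightarrow>\<^sub>E nerve M mul e m" if "f \<in> \<Phi>_hom n m" for n m f
    using nerve_map_in[OF that] by (auto simp: nerve_map_def)
next
  show "nerve_map n n (\<lambda>k\<in>{..n}. k) = (\<lambda>x\<in>nerve M mul e n. x)" for n
    unfolding nerve_map_def
  proof (rule restrict_ext)
    fix xs assume xs: "xs \<in> nerve M mul e n"
    have len: "length xs = n"
      using xs by (auto simp: nerve_def)
    have "pushforward n (\<lambda>k\<in>{..n}. k) (coord xs) j = coord xs j" if "j \<le> n" for j
      by (rule pushforward_fibre_singleton[OF xs]) (use that in auto)
    then have "of_coord n (pushforward n (\<lambda>k\<in>{..n}. k) (coord xs)) = of_coord n (coord xs)"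
      by (auto simp: of_coord_def simp del: upt_Suc)
    then show "of_coord n (pushforward n (\<lambda>k\<in>{..n}. k) (coord xs)) = xs"
      by (simp add: of_coord_coord len)
  qed
next
  fix n m l f g assume f: "f \<in> \<Phi>_hom n m" and g: "g \<in> \<Phi>_hom m l"
  show "nerve_map n l (compose {..n} g f) =
      compose (nerve M mul e n) (nerve_map m l g) (nerve_map n m f)"
    unfolding compose_def[of "nerve M mul e n"] nerve_map_def[of n l]
  proof (rule restrict_ext)
    fix xs assume xs: "xs \<in> nerve M mul e n"
    let ?b = "pushforward n f (coord xs)"
    have b: "?b \<in> tuples L m"
      using f xs by (simp add: pushforward_tuples coord_tuples)
    have "nerve_map m l g (nerve_map n m f xs) =
        of_coord l (pushforward m g (coord (of_coord m ?b)))"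
      using nerve_map_in[OF f xs] xs by (simp add: nerve_map_def)
    also have "\<dots> = of_coord l (pushforward m g ?b)"
    proof -
      \<comment> \<open>The two tuples agree only up to index \<open>m\<close>, which suffices
        because the fibres of \<open>g\<close> are taken inside \<open>{..m}\<close>.\<close>
      have "pushforward m g ?b j = pushforward m g (coord (of_coord m ?b)) j" for j
        using coord_of_coord[OF b] pushforward_closed[OF coord_tuples[OF xs]]
        by (intro pushforward_cong) auto
      then show ?thesis
        by (simp add: of_coord_def)
    qed
    also have "\<dots> = of_coord l (pushforward n (compose {..n} g f) (coord xs))"
      using pushforward_compose[OF coord_tuples[OF xs] f] by (simp add: of_coord_def)
    finally show "of_coord l (pushforward n (compose {..n} g f) (coord xs)) =
        nerve_map m l g (nerve_map n m f xs)" ..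
  qed
qed

text \<open>Only the coordinates from 1 on are visible. For \<open>i = 0\<close> and
  \<open>i = n\<close> the merged pair contains index 0, so the merged entry disappears into the
  hidden coordinate; otherwise the pair is i, i+1.\<close>

lemma nerve_map_d:
  assumes n: "n = Suc m" and i: "i \<le> n" and xs: "xs \<in> nerve M mul e n"
  shows "nerve_map n m (\<Phi>_d n i) xs = nerve_d mul n i xs"
proof (rule nth_equalityI)
  have len: "length xs = n"
    using xs by (auto simp: nerve_def)
  show "length (nerve_map n m (\<Phi>_d n i) xs) = length (nerve_d mul n i xs)"
    unfolding length_nerve_map[OF xs] using n i len by (auto simp: nerve_d_def)
  fix j assume "j < length (nerve_map n m (\<Phi>_d n i) xs)"
  then have j: "j < m"
    by (simp add: length_nerve_map[OF xs])
  \<comment> \<open>List position \<open>j\<close> is coordinate \<open>j + 1\<close>; its fibre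
    lies before, at or after the merged pair, and is \<open>{j + 1}\<close>,
    \<open>{i, i + 1}\<close> or \<open>{j + 2}\<close> respectively.\<close>
  consider "i = n \<or> j + 1 < i" | "0 < i" "i < n" "j + 1 = i" | "i < n" "i < j + 1"
    using i by linarith
  then have "pushforward n (\<Phi>_d n i) (coord xs) (j + 1) = nerve_d mul n i xs ! j"
  proof cases
    case 1
    then have "{k \<in> {..n}. \<Phi>_d n i k = j + 1} = {j + 1}"
      using j n i by (auto simp: \<Phi>_d_def split: if_splits)
    from pushforward_fibre_singleton[OF xs this] show ?thesis
      using 1 j n len i by (auto simp: nerve_d_def coord_def nth_butlast nth_append)
  next
    case 2
    then have "{k \<in> {..n}. \<Phi>_d n i k = j + 1} = {i, i + 1}"
      using j n by (auto simp: \<Phi>_d_def split: if_splits)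
    then have "pushforward n (\<Phi>_d n i) (coord xs) (j + 1) = the (mul (coord xs i) (coord xs (i + 1)))"
      unfolding pushforward_def using 2 coord_closed[OF xs] by (simp add: fprod_pair)
    then show ?thesis
      using 2 j n len by (auto simp: nerve_d_def coord_def nth_append)
  next
    case 3
    then have "{k \<in> {..n}. \<Phi>_d n i k = j + 1} = {j + 2}"
      using j n by (auto simp: \<Phi>_d_def split: if_splits)
    from pushforward_fibre_singleton[OF xs this] show ?thesis
      using 3 j n len by (auto simp: nerve_d_def coord_def nth_append nth_tl nth_Cons')
  qed
  then show "nerve_map n m (\<Phi>_d n i) xs ! j = nerve_d mul n i xs ! j"
    by (simp add: nerve_map_nth[OF xs j])
qed

text \<open>The fibre over i+1 is empty, so its product is the inserted unit; every other visible
  fibre is a singleton.\<close>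

lemma nerve_map_s:
  assumes m: "m = Suc n" and i: "i \<le> n" and xs: "xs \<in> nerve M mul e n"
  shows "nerve_map n m (\<Phi>_s n i) xs = nerve_s e n i xs"
proof (rule nth_equalityI)
  have len: "length xs = n"
    using xs by (auto simp: nerve_def)
  show "length (nerve_map n m (\<Phi>_s n i) xs) = length (nerve_s e n i xs)"
    unfolding length_nerve_map[OF xs] using m i len by (auto simp: nerve_s_def)
  fix j assume "j < length (nerve_map n m (\<Phi>_s n i) xs)"
  then have j: "j < m"
    by (simp add: length_nerve_map[OF xs])
  consider "j < i" | "j = i" | "i < j"
    by linarith
  then have "pushforward n (\<Phi>_s n i) (coord xs) (j + 1) = nerve_s e n i xs ! j"
  proof cases
    case 1
    then have "{k \<in> {..n}. \<Phi>_s n i k = j + 1} = {j + 1}"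
      using i by (auto simp: \<Phi>_s_def split: if_splits)
    from pushforward_fibre_singleton[OF xs this] show ?thesis
      using 1 i len by (simp add: nerve_s_def coord_def nth_append)
  next
    case 2
    then have "{k \<in> {..n}. \<Phi>_s n i k = j + 1} = {}"
      by (auto simp: \<Phi>_s_def split: if_splits)
    then have "pushforward n (\<Phi>_s n i) (coord xs) (j + 1) = e"
      by (simp only: pushforward_def fprod_empty option.sel)
    then show ?thesis
      using 2 i len by (simp add: nerve_s_def nth_append)
  next
    case 3
    then have "{k \<in> {..n}. \<Phi>_s n i k = j + 1} = {j}"
      using j m by (auto simp: \<Phi>_s_def split: if_splits)
    from pushforward_fibre_singleton[OF xs this] show ?thesis
      using 3 j m i len by (simp add: nerve_s_def coord_def nth_append nth_Cons')
  qed
  then show "nerve_map n m (\<Phi>_s n i) xs ! j = nerve_s e n i xs ! j"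
    by (simp add: nerve_map_nth[OF xs j])
qed

end

theorem corollary5p8:
  fixes M :: "'a set" and mul :: "'a \<Rightarrow> 'a \<Rightarrow> 'a option" and e L :: 'a
  assumes "comm_partial_monoid M mul e"
    and "orthocomplement_property M mul L"
  shows "\<exists>F. cosymmetric_structure (nerve M mul e) (nerve_d mul) (nerve_s e) F \<and>
             cyclic_structure (nerve M mul e) (nerve_d mul) (nerve_s e) (induced_tau F)"
proof -
  interpret comm_partial_monoid M mul e
    by fact
  interpret orthocomplemented_partial_monoid M mul e L
    by unfold_locales fact
  interpret cosymmetric_set "nerve M mul e" nerve_map
    by (rule cosymmetric_nerve_map)
  show ?thesis
    using structures_of_agreement[of "nerve_d mul" "nerve_s e", OF nerve_map_d nerve_map_s]
    by blast
qed

end
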